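(* Let $\theta\mapsto\varphi_\theta$ be the translation from attack-defense trees to first-order sentences over words defined in the context. Then: (1) for every attack-defense tree $\theta$ and every trace $t\in\Sigma^*$, $t\models\varphi_\theta$ if and only if $t\in[\![\theta]\!]$; (2) the size of $\varphi_\theta$ is (at most) exponential in $|\theta|$, i.e. $|\varphi_\theta| \in 2^{O(|\theta|)}$.
   Context: Fix a finite set $\mathrm{Prop}$ of propositions (with $\top := p\lor\neg p$ for $p\in\mathrm{Prop}$, and $\bot:=\neg\top$) and let $\Sigma = 2^{\mathrm{Prop}}$ be the alphabet of valuations. A trace is a word in $\Sigma^*$; $\varepsilon$ is the empty trace. The set $\mathrm{ADT}$ of attack-defense trees is defined inductively: the special leaf $\epsilon$ and every propositional formula $\gamma$ over $\mathrm{Prop}$ are in $\mathrm{ADT}$; if $\theta_1,\dots,\theta_n\in\mathrm{ADT}$ then $\mathrm{OR}(\theta_1,\dots,\theta_n)$, $\mathrm{SAND}(\theta_1,\dots,\theta_n)$, $\mathrm{AND}(\theta_1,\dots,\theta_n)\in\mathrm{ADT}$; if $\theta,\theta'\in\mathrm{ADT}$ then $\mathrm{C}(\theta,\theta')\in\mathrm{ADT}$. Size $|\theta|$: sum of the sizes of the leaves, where the leaf $\epsilon$ has size $1$ and $\gamma$ has its size as a propositional formula. Semantics $[\![\theta]\!]\subseteq\Sigma^*$: $[\![\epsilon]\!]=\{\varepsilon\}$; $[\![\gamma]\!]=\{v_1\cdots v_n\in\Sigma^* : n\ge 1,\ v_n\models\gamma\}$; $\mathrm{OR}$ is interpreted as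 union, $\mathrm{SAND}$ as concatenation (in the given order), $[\![\mathrm{C}(\theta_1,\theta_2)]\!]=[\![\theta_1]\!]\setminus[\![\theta_2]\!]$, and $[\![\mathrm{AND}(\theta_1,\dots,\theta_n)]\!]=\bigcup_{i}\big([\![\theta_i]\!]\cap\bigcap_{j\ne i}[\![\theta_j]\!]\cdot\Sigma^*\big)$. Since union, concatenation and the AND operation are associative, nodes $\mathrm{OR},\mathrm{SAND},\mathrm{AND}$ are treated as (nested) binary nodes, and a unary node is identified with its child. First-order logic $\mathrm{FO}$ over words on $\Sigma$ has a unary predicate $v(x)$ for each $v\in\Sigma$ ("the letter at position $x$ is $v$") and the binary predicate $x<y$ on positions; the empty word is allowed as a (domain-empty) model. The size of a formula is its size as a word. Relativization: for ${\bowtie}\in\{\le,>\}$ and a variable $x$ not occurring in $\varphi$, $\varphi^{\bowtie x}$ is defined by leaving atomic formulas unchanged, commuting with $\lor$ and $\neg$, and $(\exists y\,\varphi)^{\bowtie x}=\exists y\,(y\bowtie x\land\varphi^{\bowtie x})$ (with $\land,\forall$ as the usual abbreviations). $\varphi^{\le 0}$ is obtained from $\varphi^{\le x}$ by replacing each introduced expression $y\le x$ by $\bot$. Translation: $\varphi_\epsilon=\forall x\,\bot$; $\varphi_\gamma=\exists x\,(\forall y\,\neg(x<y)\land\bigvee_{v\models\gamma}v(x))$; $\varphi_{\mathrm{OR}(\theta_1,\theta_2)}=\varphi_{\theta_1}\lor\varphi_{\theta_2}$; $\varphi_{\mathrm{C}(\theta_1,\theta_2)}=\varphi_{\theta_1}\land\neg\varphi_{\theta_2}$;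 $\varphi_{\mathrm{SAND}(\theta_1,\theta_2)}=\exists x[\varphi_{\theta_1}^{\le x}\land\varphi_{\theta_2}^{>x}]\lor(\varphi_{\theta_1}^{\le 0}\land\varphi_{\theta_2})$; $\varphi_{\mathrm{AND}(\theta_1,\theta_2)}=\exists x[(\varphi_{\theta_1}^{\le x}\land\varphi_{\theta_2})\lor(\varphi_{\theta_2}^{\le x}\land\varphi_{\theta_1})]\lor(\varphi_{\theta_1}^{\le 0}\land\varphi_{\theta_2})\lor(\varphi_{\theta_2}^{\le 0}\land\varphi_{\theta_1})$. *)

theory Defs
  imports Main
begin

section \<open>Propositional formulas\<close>

text \<open>The set of propositions is the finite (hence non-empty) type \<open>'p\<close>; the alphabet of
  valuations is \<open>'p set\<close>, and a trace is an element of \<open>'p set list\<close>.\<close>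

datatype 'p pform =
    PVar 'p
  | PNeg "'p pform"
  | POr "'p pform" "'p pform"
  | PAnd "'p pform" "'p pform"

primrec psat :: "'p set \<Rightarrow> 'p pform \<Rightarrow> bool" where
  "psat v (PVar p) \<longleftrightarrow> p \<in> v"
| "psat v (PNeg \<gamma>) \<longleftrightarrow> \<not> psat v \<gamma>"
| "psat v (POr \<gamma> \<delta>) \<longleftrightarrow> psat v \<gamma> \<or> psat v \<delta>"
| "psat v (PAnd \<gamma> \<delta>) \<longleftrightarrow> psat v \<gamma> \<and> psat v \<delta>"

primrec pform_size :: "'p pform \<Rightarrow> nat" where
  "pform_size (PVar p) = 1"
| "pform_size (PNeg \<gamma>) = 1 + pform_size \<gamma>"
| "pform_size (POr \<gamma> \<delta>) = 1 + pform_size \<gamma> + pform_size \<delta>"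
| "pform_size (PAnd \<gamma> \<delta>) = 1 + pform_size \<gamma> + pform_size \<delta>"


section \<open>Attack-defense trees\<close>

text \<open>A node with children \<open>\<theta>\<^sub>1, \<dots>, \<theta>\<^sub>n\<close>, \<open>n \<ge> 1\<close>, is given by its first child and the list of
  the remaining ones, so that there are no nodes without children.\<close>

datatype 'p adt =
    Eps
  | Leaf "'p pform"
  | OR_node "'p adt" "'p adt list"
  | SAND_node "'p adt" "'p adt list"
  | AND_node "'p adt" "'p adt list"
  | Counter "'p adt" "'p adt"

primrec adt_size :: "'p adt \<Rightarrow> nat" where
  "adt_size Eps = 1"
| "adt_size (Leaf \<gamma>) = pform_size \<gamma>"
| "adt_size (OR_node \<theta> \<theta>s) = adt_size \<theta> + sum_list (map adt_size \<theta>s)"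
| "adt_size (SAND_node \<theta> \<theta>s) = adt_size \<theta> + sum_list (map adt_size \<theta>s)"
| "adt_size (AND_node \<theta> \<theta>s) = adt_size \<theta> + sum_list (map adt_size \<theta>s)"
| "adt_size (Counter \<theta> \<theta>') = adt_size \<theta> + adt_size \<theta>'"

definition conc :: "'a list set \<Rightarrow> 'a list set \<Rightarrow> 'a list set" where
  "conc K L = {u @ v | u v. u \<in> K \<and> v \<in> L}"

text \<open>For a one-element list the intersection below is over the empty index set, hence \<open>UNIV\<close>.\<close>

definition and_lang :: "'a list set list \<Rightarrow> 'a list set" where
  "and_lang Ls =
     (\<Union>i<length Ls. Ls ! i \<inter> (\<Inter>j\<in>{..<length Ls} - {i}. conc (Ls ! j) UNIV))"

primrec adt_sem :: "'p adt \<Rightarrow> 'p set list set" where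
  "adt_sem Eps = {[]}"
| "adt_sem (Leaf \<gamma>) = {t. t \<noteq> [] \<and> psat (last t) \<gamma>}"
| "adt_sem (OR_node \<theta> \<theta>s) = \<Union> (set (adt_sem \<theta> # map adt_sem \<theta>s))"
| "adt_sem (SAND_node \<theta> \<theta>s) = concat ` listset (adt_sem \<theta> # map adt_sem \<theta>s)"
| "adt_sem (AND_node \<theta> \<theta>s) = and_lang (adt_sem \<theta> # map adt_sem \<theta>s)"
| "adt_sem (Counter \<theta> \<theta>') = adt_sem \<theta> - adt_sem \<theta>'"


section \<open>First-order logic over words\<close>

text \<open>\<open>Letter v x\<close> is the atomic formula \<open>v(x)\<close>.\<close>

datatype 'a fo =
    Bot
  | Letter 'a nat
  | Less nat nat
  | Neg "'a fo"
  | Or "'a fo" "'a fo"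
  | Ex nat "'a fo"

abbreviation And :: "'a fo \<Rightarrow> 'a fo \<Rightarrow> 'a fo" where
  "And \<phi> \<psi> \<equiv> Neg (Or (Neg \<phi>) (Neg \<psi>))"

abbreviation All :: "nat \<Rightarrow> 'a fo \<Rightarrow> 'a fo" where
  "All x \<phi> \<equiv> Neg (Ex x (Neg \<phi>))"

primrec fo_vars :: "'a fo \<Rightarrow> nat set" where
  "fo_vars Bot = {}"
| "fo_vars (Letter v x) = {x}"
| "fo_vars (Less x y) = {x, y}"
| "fo_vars (Neg \<phi>) = fo_vars \<phi>"
| "fo_vars (Or \<phi> \<psi>) = fo_vars \<phi> \<union> fo_vars \<psi>"
| "fo_vars (Ex x \<phi>) = insert x (fo_vars \<phi>)"

primrec fo_free :: "'a fo \<Rightarrow> nat set" where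
  "fo_free Bot = {}"
| "fo_free (Letter v x) = {x}"
| "fo_free (Less x y) = {x, y}"
| "fo_free (Neg \<phi>) = fo_free \<phi>"
| "fo_free (Or \<phi> \<psi>) = fo_free \<phi> \<union> fo_free \<psi>"
| "fo_free (Ex x \<phi>) = fo_free \<phi> - {x}"

text \<open>Positions of a word \<open>w\<close> are \<open>0, \<dots>, length w - 1\<close>. Assignments may take values that are not
  positions, so that they also exist over the empty word; quantifiers range over positions only,
  and the values assigned to variables that are not free are irrelevant (\<open>fo_sat_cong\<close>).\<close>

primrec fo_sat :: "'a list \<Rightarrow> (nat \<Rightarrow> nat) \<Rightarrow> 'a fo \<Rightarrow> bool" where
  "fo_sat w \<sigma> Bot \<longleftrightarrow> False"
| "fo_sat w \<sigma> (Letter v x) \<longleftrightarrow> \<sigma> x < length w \<and> w ! \<sigma> x = v"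
| "fo_sat w \<sigma> (Less x y) \<longleftrightarrow> \<sigma> x < \<sigma> y"
| "fo_sat w \<sigma> (Neg \<phi>) \<longleftrightarrow> \<not> fo_sat w \<sigma> \<phi>"
| "fo_sat w \<sigma> (Or \<phi> \<psi>) \<longleftrightarrow> fo_sat w \<sigma> \<phi> \<or> fo_sat w \<sigma> \<psi>"
| "fo_sat w \<sigma> (Ex x \<phi>) \<longleftrightarrow> (\<exists>i<length w. fo_sat w (\<sigma>(x := i)) \<phi>)"

text \<open>Meant for sentences; the formulas \<open>adt_fo \<theta>\<close> below are sentences (\<open>fo_free_adt_fo\<close>).\<close>

definition fo_models :: "'a list \<Rightarrow> 'a fo \<Rightarrow> bool"  (infix "\<Turnstile>" 50) where
  "w \<Turnstile> \<phi> \<longleftrightarrow> (\<forall>\<sigma>. fo_sat w \<sigma> \<phi>)"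

lemma fo_sat_cong:
  "(\<And>x. x \<in> fo_free \<phi> \<Longrightarrow> \<sigma> x = \<tau> x) \<Longrightarrow> fo_sat w \<sigma> \<phi> \<longleftrightarrow> fo_sat w \<tau> \<phi>"
proof (induction \<phi> arbitrary: \<sigma> \<tau>)
  case (Neg \<phi>)
  have "fo_sat w \<sigma> \<phi> \<longleftrightarrow> fo_sat w \<tau> \<phi>"
    by (rule Neg.IH) (simp add: Neg.prems)
  then show ?case by simp
next
  case (Or \<phi> \<psi>)
  have "fo_sat w \<sigma> \<phi> \<longleftrightarrow> fo_sat w \<tau> \<phi>"
    by (rule Or.IH(1)) (simp add: Or.prems)
  moreover have "fo_sat w \<sigma> \<psi> \<longleftrightarrow> fo_sat w \<tau> \<psi>"
    by (rule Or.IH(2)) (simp add: Or.prems)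
  ultimately show ?case by simp
next
  case (Ex x \<phi>)
  have "fo_sat w (\<sigma>(x := i)) \<phi> \<longleftrightarrow> fo_sat w (\<tau>(x := i)) \<phi>" for i
    by (rule Ex.IH) (simp add: Ex.prems)
  then show ?case by simp
qed simp_all

text \<open>The size of a formula is the length of the word that spells it out; abbreviations are
  expanded, and every variable and every letter of the alphabet is a single symbol.\<close>

datatype 'a fo_symbol =
    SBot | SLetter 'a | SVar nat | SLess | SNeg | SOr | SEx | SLParen | SRParen

primrec fo_word :: "'a fo \<Rightarrow> 'a fo_symbol list" where
  "fo_word Bot = [SBot]"
| "fo_word (Letter v x) = [SLetter v, SLParen, SVar x, SRParen]"
| "fo_word (Less x y) = [SLParen, SVar x, SLess, SVar y, SRParen]"
| "fo_word (Neg \<phi>) = SNeg # fo_word \<phi>"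
| "fo_word (Or \<phi> \<psi>) = SLParen # fo_word \<phi> @ SOr # fo_word \<psi> @ [SRParen]"
| "fo_word (Ex x \<phi>) = SEx # SVar x # fo_word \<phi>"

definition fo_size :: "'a fo \<Rightarrow> nat" where
  "fo_size \<phi> = length (fo_word \<phi>)"


section \<open>Relativization\<close>

text \<open>\<open>relativize g\<close> inserts the guard \<open>g y\<close> after each quantifier \<open>\<exists>y\<close>. In \<open>rel_le x\<close> and
  \<open>rel_gt x\<close> the variable \<open>x\<close> must not occur in the formula; \<open>y \<le> x\<close> is \<open>\<not> (x < y)\<close>.\<close>

primrec relativize :: "(nat \<Rightarrow> 'a fo) \<Rightarrow> 'a fo \<Rightarrow> 'a fo" where
  "relativize g Bot = Bot"
| "relativize g (Letter v x) = Letter v x"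
| "relativize g (Less x y) = Less x y"
| "relativize g (Neg \<phi>) = Neg (relativize g \<phi>)"
| "relativize g (Or \<phi> \<psi>) = Or (relativize g \<phi>) (relativize g \<psi>)"
| "relativize g (Ex y \<phi>) = Ex y (And (g y) (relativize g \<phi>))"

definition rel_le :: "nat \<Rightarrow> 'a fo \<Rightarrow> 'a fo" where
  "rel_le x = relativize (\<lambda>y. Neg (Less x y))"

definition rel_gt :: "nat \<Rightarrow> 'a fo \<Rightarrow> 'a fo" where
  "rel_gt x = relativize (\<lambda>y. Less x y)"

definition rel_le0 :: "'a fo \<Rightarrow> 'a fo" where
  "rel_le0 = relativize (\<lambda>y. Bot)"


section \<open>Translation\<close>

fun big_or :: "'a fo list \<Rightarrow> 'a fo" where
  "big_or [] = Bot"
| "big_or [\<phi>] = \<phi>"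
| "big_or (\<phi> # \<psi> # \<psi>s) = Or \<phi> (big_or (\<psi> # \<psi>s))"

text \<open>An arbitrary enumeration without repetitions of the valuations satisfying \<open>\<gamma>\<close>.\<close>

definition valuations :: "'p::finite pform \<Rightarrow> 'p set list" where
  "valuations \<gamma> = (SOME vs. distinct vs \<and> set vs = {v. psat v \<gamma>})"

lemma valuations:
  "distinct (valuations \<gamma>)" "set (valuations \<gamma>) = {v. psat v \<gamma>}"
proof -
  have "\<exists>vs. distinct vs \<and> set vs = {v. psat v \<gamma>}"
    using finite_distinct_list[of "{v. psat v \<gamma>}"] by auto
  then have "distinct (valuations \<gamma>) \<and> set (valuations \<gamma>) = {v. psat v \<gamma>}"
    unfolding valuations_def by (rule someI_ex)
  then show "distinct (valuations \<gamma>)" "set (valuations \<gamma>) = {v. psat v \<gamma>}" by auto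
qed

definition fresh :: "nat set \<Rightarrow> nat" where
  "fresh V = (LEAST x. x \<notin> V)"

lemma finite_fo_vars: "finite (fo_vars \<phi>)"
  by (induction \<phi>) auto

lemma fresh_notin: "finite V \<Longrightarrow> fresh V \<notin> V"
  unfolding fresh_def by (rule LeastI_ex) (rule ex_new_if_finite[OF infinite_UNIV_nat])

definition tr_leaf :: "'p::finite pform \<Rightarrow> 'p set fo" where
  "tr_leaf \<gamma> =
     Ex 0 (And (All 1 (Neg (Less 0 1))) (big_or (map (\<lambda>v. Letter v 0) (valuations \<gamma>))))"

definition tr_sand :: "'a fo \<Rightarrow> 'a fo \<Rightarrow> 'a fo" where
  "tr_sand \<phi> \<psi> =
     (let x = fresh (fo_vars \<phi> \<union> fo_vars \<psi>) in
      Or (Ex x (And (rel_le x \<phi>) (rel_gt x \<psi>)))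
         (And (rel_le0 \<phi>) \<psi>))"

definition tr_and :: "'a fo \<Rightarrow> 'a fo \<Rightarrow> 'a fo" where
  "tr_and \<phi> \<psi> =
     (let x = fresh (fo_vars \<phi> \<union> fo_vars \<psi>) in
      Or (Or (Ex x (Or (And (rel_le x \<phi>) \<psi>) (And (rel_le x \<psi>) \<phi>)))
             (And (rel_le0 \<phi>) \<psi>))
         (And (rel_le0 \<psi>) \<phi>))"

text \<open>Nodes with more than two children are read as nested binary nodes (nested to the left), and
  a node with one child is identified with that child.\<close>

primrec adt_fo :: "'p::finite adt \<Rightarrow> 'p set fo" where
  "adt_fo Eps = All 0 Bot"
| "adt_fo (Leaf \<gamma>) = tr_leaf \<gamma>"
| "adt_fo (OR_node \<theta> \<theta>s) = foldl Or (adt_fo \<theta>) (map adt_fo \<theta>s)"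
| "adt_fo (SAND_node \<theta> \<theta>s) = foldl tr_sand (adt_fo \<theta>) (map adt_fo \<theta>s)"
| "adt_fo (AND_node \<theta> \<theta>s) = foldl tr_and (adt_fo \<theta>) (map adt_fo \<theta>s)"
| "adt_fo (Counter \<theta> \<theta>') = And (adt_fo \<theta>) (Neg (adt_fo \<theta>'))"

lemma fo_free_relativize:
  "(\<And>y. fo_free (g y) \<subseteq> insert y X) \<Longrightarrow> fo_free (relativize g \<phi>) \<subseteq> fo_free \<phi> \<union> X"
proof (induction \<phi>)
  case (Ex y \<phi>)
  have "fo_free (g y) \<subseteq> insert y X" "fo_free (relativize g \<phi>) \<subseteq> fo_free \<phi> \<union> X"
    using Ex.prems Ex.IH by simp_all
  then show ?case by auto
qed auto

lemma fo_free_big_or: "fo_free (big_or \<phi>s) = \<Union> (fo_free ` set \<phi>s)"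
  by (induction \<phi>s rule: big_or.induct) auto

lemma fo_free_tr:
  assumes "fo_free \<phi> = {}" "fo_free \<psi> = {}"
  shows "fo_free (Or \<phi> \<psi>) = {}" "fo_free (tr_sand \<phi> \<psi>) = {}" "fo_free (tr_and \<phi> \<psi>) = {}"
proof -
  have le: "fo_free (rel_le x \<chi>) \<subseteq> {x}" and gt: "fo_free (rel_gt x \<chi>) \<subseteq> {x}"
    if "fo_free \<chi> = {}" for x and \<chi> :: "'a fo"
    using fo_free_relativize[of "\<lambda>y. Neg (Less x y)" "{x}" \<chi>]
      fo_free_relativize[of "\<lambda>y. Less x y" "{x}" \<chi>] that
    by (simp_all add: rel_le_def rel_gt_def)
  have le0: "fo_free (rel_le0 \<chi>) = {}" if "fo_free \<chi> = {}" for \<chi> :: "'a fo"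
    using fo_free_relativize[of "\<lambda>y. Bot" "{}" \<chi>] that by (simp add: rel_le0_def)
  show "fo_free (Or \<phi> \<psi>) = {}" using assms by simp
  show "fo_free (tr_sand \<phi> \<psi>) = {}"
    using assms le gt by (simp add: tr_sand_def Let_def le0 Un_subset_iff)
  show "fo_free (tr_and \<phi> \<psi>) = {}"
    using assms le by (simp add: tr_and_def Let_def le0)
qed

lemma fo_free_foldl:
  assumes "\<And>\<phi> \<psi>. fo_free \<phi> = {} \<Longrightarrow> fo_free \<psi> = {} \<Longrightarrow> fo_free (f \<phi> \<psi>) = {}"
    and "fo_free \<phi> = {}" "\<forall>\<psi>\<in>set \<psi>s. fo_free \<psi> = {}"
  shows "fo_free (foldl f \<phi> \<psi>s) = {}"
  using assms(2,3) by (induction \<psi>s arbitrary: \<phi>) (simp_all add: assms(1))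

lemma fo_free_adt_fo: "fo_free (adt_fo \<theta>) = {}"
proof (induction \<theta>)
  case (Leaf \<gamma>)
  show ?case by (auto simp: tr_leaf_def fo_free_big_or)
next
  case (OR_node \<theta> \<theta>s)
  then show ?case
    unfolding adt_fo.simps by (intro fo_free_foldl[OF fo_free_tr(1)]) simp_all
next
  case (SAND_node \<theta> \<theta>s)
  then show ?case
    unfolding adt_fo.simps by (intro fo_free_foldl[OF fo_free_tr(2)]) simp_all
next
  case (AND_node \<theta> \<theta>s)
  then show ?case
    unfolding adt_fo.simps by (intro fo_free_foldl[OF fo_free_tr(3)]) simp_all
qed simp_all

end

theory Submission
  imports Defs
begin

text \<open>Relativizing a sentence to the positions \<open>\<le> x\<close> (\<open>> x\<close>) evaluates it on the prefix ending at
  \<open>x\<close> (on the suffix after \<open>x\<close>), so the binary translations realize the binary operations on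
  languages. The \<open>n\<close>-ary \<open>AND\<close> is an iterated binary one because of two prefixes of a word, one is a
  prefix of the other. For the size, relativization is linear, so a binary node multiplies the total
  size of its children by at most a constant; since the size of a tree exceeds its number of binary
  nodes, the bound is exponential.\<close>

section \<open>Correctness\<close>

definition fo_lang :: "'a fo \<Rightarrow> 'a list set" where
  "fo_lang \<phi> = {w. w \<Turnstile> \<phi>}"

text \<open>Since \<open>fo_models\<close> quantifies over all assignments, it need not commute with
  \<open>Neg\<close> and \<open>Or\<close>. For sentences any single assignment decides truth, so
  connectives can be evaluated through \<open>fo_sat\<close>.\<close>

lemma fo_models_iff_sat:
  assumes "fo_free \<phi> = {}"
  shows "w \<Turnstile> \<phi> \<longleftrightarrow> fo_sat w \<sigma> \<phi>"
  unfolding fo_models_def using fo_sat_cong[of \<phi>] assms by blast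

text \<open>The induction needs open formulas. The guard keeps the values of free variables inside
  the prefix, where both words carry the same letters; as \<open>x\<close> does not occur, no
  quantifier moves the cut.\<close>

lemma fo_sat_rel_le:
  assumes "x \<notin> fo_vars \<phi>" "\<sigma> x < length w" "\<And>y. y \<in> fo_free \<phi> \<Longrightarrow> \<sigma> y \<le> \<sigma> x"
  shows "fo_sat w \<sigma> (rel_le x \<phi>) \<longleftrightarrow> fo_sat (take (Suc (\<sigma> x)) w) \<sigma> \<phi>"
  using assms
proof (induction \<phi> arbitrary: \<sigma>)
  case (Letter v y)
  then show ?case by (auto simp: rel_le_def less_Suc_eq_le)
next
  case (Ex y \<phi>)
  have "fo_sat w (\<sigma>(y := i)) (rel_le x \<phi>) \<longleftrightarrow> fo_sat (take (Suc (\<sigma> x)) w) (\<sigma>(y := i)) \<phi>"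
    if "i \<le> \<sigma> x" for i
  proof -
    have "(\<sigma>(y := i)) z \<le> (\<sigma>(y := i)) x" if "z \<in> fo_free \<phi>" for z
      using that \<open>i \<le> \<sigma> x\<close> Ex.prems by auto
    moreover have "x \<notin> fo_vars \<phi>" "(\<sigma>(y := i)) x = \<sigma> x"
      using Ex.prems by auto
    ultimately show ?thesis using Ex.IH[of "\<sigma>(y := i)"] Ex.prems(2) by metis
  qed
  moreover have "i < length (take (Suc (\<sigma> x)) w) \<longleftrightarrow> i < length w \<and> i \<le> \<sigma> x" for i
    by auto
  ultimately show ?case
    unfolding fo_sat.simps rel_le_def relativize.simps using Ex.prems by (auto simp: not_less)
qed (auto simp: rel_le_def)

text \<open>Positions of the suffix are renumbered from 0. The bound on free variables keeps the
  truncated subtraction faithful, so it preserves and reflects both letters and order.\<close>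

lemma fo_sat_rel_gt:
  assumes "x \<notin> fo_vars \<phi>" "\<sigma> x < length w" "\<And>y. y \<in> fo_free \<phi> \<Longrightarrow> \<sigma> x < \<sigma> y"
  shows "fo_sat w \<sigma> (rel_gt x \<phi>) \<longleftrightarrow>
         fo_sat (drop (Suc (\<sigma> x)) w) (\<lambda>y. \<sigma> y - Suc (\<sigma> x)) \<phi>"
  using assms
proof (induction \<phi> arbitrary: \<sigma>)
  case (Letter v y)
  then have "Suc (\<sigma> x) \<le> \<sigma> y" by (simp add: Suc_le_eq)
  with Letter show ?case by (auto simp: rel_gt_def)
next
  case (Less y z)
  then have "\<sigma> x < \<sigma> y" "\<sigma> x < \<sigma> z" by auto
  then show ?case by (auto simp: rel_gt_def)
next
  case (Ex y \<phi>)
  let ?w = "drop (Suc (\<sigma> x)) w" and ?\<tau> = "\<lambda>z. \<sigma> z - Suc (\<sigma> x)"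
  \<comment> \<open>Here \<open>y\<close> differs from \<open>x\<close>, so updating
    \<open>y\<close> leaves the offset unchanged and commutes with renumbering.\<close>
  have shift: "fo_sat w (\<sigma>(y := i)) (rel_gt x \<phi>) \<longleftrightarrow> fo_sat ?w (?\<tau>(y := i - Suc (\<sigma> x))) \<phi>"
    if "\<sigma> x < i" for i
  proof -
    have "(\<lambda>z. (\<sigma>(y := i)) z - Suc ((\<sigma>(y := i)) x)) = ?\<tau>(y := i - Suc (\<sigma> x))"
      using Ex.prems by auto
    moreover have "(\<sigma>(y := i)) x < (\<sigma>(y := i)) z" if "z \<in> fo_free \<phi>" for z
      using that \<open>\<sigma> x < i\<close> Ex.prems by auto
    moreover have "x \<notin> fo_vars \<phi>" "(\<sigma>(y := i)) x = \<sigma> x"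
      using Ex.prems by auto
    ultimately show ?thesis using Ex.IH[of "\<sigma>(y := i)"] Ex.prems(2) by metis
  qed
  have "(\<exists>i<length w. \<sigma> x < i \<and> fo_sat w (\<sigma>(y := i)) (rel_gt x \<phi>)) \<longleftrightarrow>
        (\<exists>j<length ?w. fo_sat ?w (?\<tau>(y := j)) \<phi>)" (is "?L \<longleftrightarrow> ?R")
  proof
    assume ?L
    then obtain i where "i < length w" "\<sigma> x < i" "fo_sat w (\<sigma>(y := i)) (rel_gt x \<phi>)" by blast
    then show ?R using shift[of i] by (intro exI[of _ "i - Suc (\<sigma> x)"]) auto
  next
    assume ?R
    then obtain j where "j < length ?w" "fo_sat ?w (?\<tau>(y := j)) \<phi>" by blast
    then show ?L using shift[of "j + Suc (\<sigma> x)"] by (intro exI[of _ "j + Suc (\<sigma> x)"]) auto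
  qed
  then show ?case using Ex.prems by (simp add: rel_gt_def)
qed (auto simp: rel_gt_def)

text \<open>Both sides of a quantifier are false: the guard is \<open>Bot\<close> on the left, the
  domain is empty on the right. So the induction never has to look below a quantifier, where the
  body may be open.\<close>

lemma fo_sat_rel_le0:
  "fo_free \<phi> = {} \<Longrightarrow> fo_sat w \<sigma> (rel_le0 \<phi>) \<longleftrightarrow> fo_sat [] \<sigma> \<phi>"
  by (induction \<phi>) (auto simp: rel_le0_def)

lemma fresh_fo_vars:
  "fresh (fo_vars \<phi> \<union> fo_vars \<psi>) \<notin> fo_vars \<phi>" "fresh (fo_vars \<phi> \<union> fo_vars \<psi>) \<notin> fo_vars \<psi>"
  using fresh_notin[of "fo_vars \<phi> \<union> fo_vars \<psi>"] by (auto simp: finite_fo_vars)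

lemma fo_models_rel:
  assumes "fo_free \<phi> = {}"
  shows "x \<notin> fo_vars \<phi> \<Longrightarrow> i < length w \<Longrightarrow>
           fo_sat w (\<sigma>(x := i)) (rel_le x \<phi>) \<longleftrightarrow> take (Suc i) w \<Turnstile> \<phi>"
    and "x \<notin> fo_vars \<phi> \<Longrightarrow> i < length w \<Longrightarrow>
           fo_sat w (\<sigma>(x := i)) (rel_gt x \<phi>) \<longleftrightarrow> drop (Suc i) w \<Turnstile> \<phi>"
    and "fo_sat w \<sigma> (rel_le0 \<phi>) \<longleftrightarrow> [] \<Turnstile> \<phi>"
    and "fo_sat w \<sigma> \<phi> \<longleftrightarrow> w \<Turnstile> \<phi>"
proof -
  show "fo_sat w (\<sigma>(x := i)) (rel_le x \<phi>) \<longleftrightarrow> take (Suc i) w \<Turnstile> \<phi>"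
    if "x \<notin> fo_vars \<phi>" "i < length w"
    using fo_sat_rel_le[of x \<phi> "\<sigma>(x := i)" w] that assms
    by (simp add: fo_models_iff_sat[OF assms, of _ "\<sigma>(x := i)"])
  show "fo_sat w (\<sigma>(x := i)) (rel_gt x \<phi>) \<longleftrightarrow> drop (Suc i) w \<Turnstile> \<phi>"
    if "x \<notin> fo_vars \<phi>" "i < length w"
    using fo_sat_rel_gt[of x \<phi> "\<sigma>(x := i)" w] that assms
    by (simp add: fo_models_iff_sat[OF assms, of _ "\<lambda>y. (\<sigma>(x := i)) y - Suc i"])
  show "fo_sat w \<sigma> (rel_le0 \<phi>) \<longleftrightarrow> [] \<Turnstile> \<phi>"
    using assms by (simp add: fo_sat_rel_le0 fo_models_iff_sat[of _ _ \<sigma>])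
  show "fo_sat w \<sigma> \<phi> \<longleftrightarrow> w \<Turnstile> \<phi>"
    using assms by (simp add: fo_models_iff_sat[of _ _ \<sigma>])
qed

section \<open>Languages of the binary translations\<close>

lemma mem_conc_iff: "w \<in> conc K L \<longleftrightarrow> (\<exists>n\<le>length w. take n w \<in> K \<and> drop n w \<in> L)"
proof
  assume "w \<in> conc K L"
  then obtain u v where "w = u @ v" "u \<in> K" "v \<in> L" by (auto simp: conc_def)
  then show "\<exists>n\<le>length w. take n w \<in> K \<and> drop n w \<in> L"
    by (intro exI[of _ "length u"]) simp
next
  assume "\<exists>n\<le>length w. take n w \<in> K \<and> drop n w \<in> L"
  then show "w \<in> conc K L"
    unfolding conc_def by (metis (mono_tags, lifting) append_take_drop_id mem_Collect_eq)
qed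

text \<open>A cut of length \<open>Suc i\<close> is named by position \<open>i\<close>, but the
  empty prefix is named by no position. This is why the translations have separate disjuncts with
  \<open>rel_le0\<close>.\<close>

lemma ex_le_iff_zero_or_Suc:
  "(\<exists>n\<le>(m::nat). P n) \<longleftrightarrow> (\<exists>i<m. P (Suc i)) \<or> P 0"
  by (metis Suc_le_eq le0 not0_implies_Suc)

lemma fo_lang_tr_sand:
  assumes "fo_free \<phi> = {}" "fo_free \<psi> = {}"
  shows "fo_lang (tr_sand \<phi> \<psi>) = conc (fo_lang \<phi>) (fo_lang \<psi>)"
proof (rule set_eqI)
  fix w
  have "w \<Turnstile> tr_sand \<phi> \<psi> \<longleftrightarrow> fo_sat w (\<lambda>_. 0) (tr_sand \<phi> \<psi>)"
    using assms by (intro fo_models_iff_sat fo_free_tr)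
  also have "\<dots> \<longleftrightarrow> (\<exists>i<length w. take (Suc i) w \<Turnstile> \<phi> \<and> drop (Suc i) w \<Turnstile> \<psi>) \<or> [] \<Turnstile> \<phi> \<and> w \<Turnstile> \<psi>"
    using assms by (auto simp: tr_sand_def Let_def fo_models_rel fresh_fo_vars)
  also have "\<dots> \<longleftrightarrow> (\<exists>n\<le>length w. take n w \<Turnstile> \<phi> \<and> drop n w \<Turnstile> \<psi>)"
    by (simp add: ex_le_iff_zero_or_Suc)
  finally show "w \<in> fo_lang (tr_sand \<phi> \<psi>) \<longleftrightarrow> w \<in> conc (fo_lang \<phi>) (fo_lang \<psi>)"
    by (simp add: fo_lang_def mem_conc_iff)
qed

definition and2 :: "'a list set \<Rightarrow> 'a list set \<Rightarrow> 'a list set" where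
  "and2 K L = (K \<inter> conc L UNIV) \<union> (L \<inter> conc K UNIV)"

lemma fo_lang_tr_and:
  assumes "fo_free \<phi> = {}" "fo_free \<psi> = {}"
  shows "fo_lang (tr_and \<phi> \<psi>) = and2 (fo_lang \<phi>) (fo_lang \<psi>)"
proof (rule set_eqI)
  fix w
  have "w \<Turnstile> tr_and \<phi> \<psi> \<longleftrightarrow> fo_sat w (\<lambda>_. 0) (tr_and \<phi> \<psi>)"
    using assms by (intro fo_models_iff_sat fo_free_tr)
  also have "\<dots> \<longleftrightarrow> w \<Turnstile> \<psi> \<and> ((\<exists>i<length w. take (Suc i) w \<Turnstile> \<phi>) \<or> [] \<Turnstile> \<phi>) \<or>
                    w \<Turnstile> \<phi> \<and> ((\<exists>i<length w. take (Suc i) w \<Turnstile> \<psi>) \<or> [] \<Turnstile> \<psi>)"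
    using assms by (auto simp: tr_and_def Let_def fo_models_rel fresh_fo_vars)
  also have "\<dots> \<longleftrightarrow> w \<Turnstile> \<psi> \<and> (\<exists>n\<le>length w. take n w \<Turnstile> \<phi>) \<or>
                    w \<Turnstile> \<phi> \<and> (\<exists>n\<le>length w. take n w \<Turnstile> \<psi>)"
    by (simp add: ex_le_iff_zero_or_Suc)
  finally show "w \<in> fo_lang (tr_and \<phi> \<psi>) \<longleftrightarrow> w \<in> and2 (fo_lang \<phi>) (fo_lang \<psi>)"
    by (auto simp: fo_lang_def mem_conc_iff and2_def)
qed

lemma fo_lang_Or:
  assumes "fo_free \<phi> = {}" "fo_free \<psi> = {}"
  shows "fo_lang (Or \<phi> \<psi>) = fo_lang \<phi> \<union> fo_lang \<psi>"
proof -
  have "w \<Turnstile> Or \<phi> \<psi> \<longleftrightarrow> w \<Turnstile> \<phi> \<or> w \<Turnstile> \<psi>" for w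
    using assms by (simp add: fo_models_iff_sat[where \<sigma> = "\<lambda>_. 0"])
  then show ?thesis by (auto simp: fo_lang_def)
qed

text \<open>Lifts a binary law to left-nested nodes; closure of \<open>f\<close> on sentences keeps
  the accumulator within reach of the law.\<close>

lemma fo_lang_foldl:
  assumes free: "\<And>\<phi> \<psi>. fo_free \<phi> = {} \<Longrightarrow> fo_free \<psi> = {} \<Longrightarrow> fo_free (f \<phi> \<psi>) = {}"
    and lang: "\<And>\<phi> \<psi>. fo_free \<phi> = {} \<Longrightarrow> fo_free \<psi> = {} \<Longrightarrow>
                 fo_lang (f \<phi> \<psi>) = F (fo_lang \<phi>) (fo_lang \<psi>)"
    and "fo_free \<phi> = {}" "\<forall>\<psi>\<in>set \<psi>s. fo_free \<psi> = {}"
  shows "fo_lang (foldl f \<phi> \<psi>s) = foldl F (fo_lang \<phi>) (map fo_lang \<psi>s)"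
  using assms(3,4) by (induction \<psi>s arbitrary: \<phi>) (simp_all add: free lang)

section \<open>Iterated binary operations and their n-ary forms\<close>

lemma foldl_Un: "foldl (\<union>) K Ls = \<Union> (set (K # Ls))"
  by (induction Ls arbitrary: K) auto

lemma conc_assoc: "conc (conc J K) L = conc J (conc K L)"
  unfolding conc_def by (auto, metis append.assoc, metis append.assoc)

lemma concat_listset_Cons: "concat ` listset (K # Ls) = conc K (concat ` listset Ls)"
proof -
  have "listset (K # Ls) = (\<lambda>(u, us). u # us) ` (K \<times> listset Ls)"
    by (auto simp: set_Cons_def)
  then have "concat ` listset (K # Ls) = (\<lambda>(u, us). u @ concat us) ` (K \<times> listset Ls)"
    by (simp only: image_image) (simp add: case_prod_unfold)
  also have "\<dots> = conc K (concat ` listset Ls)"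
    by (auto simp: conc_def)
  finally show ?thesis .
qed

text \<open>The fold merges the first two factors into one; peeling off first factors on both sides
  leaves exactly associativity of \<open>conc\<close>.\<close>

lemma foldl_conc: "foldl conc K Ls = concat ` listset (K # Ls)"
proof (induction Ls arbitrary: K)
  case Nil
  show ?case by (simp add: concat_listset_Cons conc_def del: listset.simps(2))
next
  case (Cons L Ls)
  then show ?case by (simp only: foldl.simps concat_listset_Cons conc_assoc)
qed

lemma mem_conc_UNIV: "u \<in> K \<Longrightarrow> u @ v \<in> conc K UNIV"
  by (auto simp: conc_def)

lemma subset_conc_UNIV: "K \<subseteq> conc K UNIV"
  using mem_conc_UNIV[of _ K "[]"] by auto

lemma conc_UNIV_append: "w \<in> conc K UNIV \<Longrightarrow> w @ v \<in> conc K UNIV"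
  unfolding conc_def by (auto, metis)

text \<open>The key to iterating \<open>and2\<close>: the condition of having a prefix in the
  accumulated language splits into one condition per child.\<close>

lemma conc_and2_UNIV: "conc (and2 K L) UNIV = conc K UNIV \<inter> conc L UNIV"
proof
  show "conc (and2 K L) UNIV \<subseteq> conc K UNIV \<inter> conc L UNIV"
  proof
    fix w assume "w \<in> conc (and2 K L) UNIV"
    then obtain u v where w: "w = u @ v" "u \<in> and2 K L" by (auto simp: conc_def)
    then have "u \<in> conc K UNIV" "u \<in> conc L UNIV"
      unfolding and2_def using subset_conc_UNIV by blast+
    then show "w \<in> conc K UNIV \<inter> conc L UNIV" using w conc_UNIV_append by blast
  qed
  show "conc K UNIV \<inter> conc L UNIV \<subseteq> conc (and2 K L) UNIV"
  proof
    fix w assume "w \<in> conc K UNIV \<inter> conc L UNIV"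
    then obtain u u' v v' where w: "w = u @ u'" "w = v @ v'" "u \<in> K" "v \<in> L"
      unfolding conc_def by blast
    \<comment> \<open>Two prefixes of \<open>w\<close> are comparable. The longer one is in its own
      language and extends a word of the other, hence lies in \<open>and2 K L\<close>.\<close>
    then consider x where "u = v @ x" | x where "v = u @ x"
      by (metis append_eq_append_conv2)
    then have "u \<in> and2 K L \<or> v \<in> and2 K L"
      using w by cases (auto simp: and2_def intro: mem_conc_UNIV)
    then show "w \<in> conc (and2 K L) UNIV"
      using w mem_conc_UNIV by metis
  qed
qed

lemma mem_and_lang_iff:
  "w \<in> and_lang Ls \<longleftrightarrow> (\<exists>L\<in>set Ls. w \<in> L) \<and> (\<forall>L\<in>set Ls. w \<in> conc L UNIV)"
proof -
  have "(\<forall>j\<in>{..<length Ls} - {i}. w \<in> conc (Ls ! j) UNIV) \<longleftrightarrow>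
        (\<forall>j<length Ls. w \<in> conc (Ls ! j) UNIV)" if "w \<in> Ls ! i" for i
    using that subset_conc_UNIV by blast
  then have "w \<in> and_lang Ls \<longleftrightarrow>
      (\<exists>i<length Ls. w \<in> Ls ! i) \<and> (\<forall>j<length Ls. w \<in> conc (Ls ! j) UNIV)"
    by (auto simp: and_lang_def)
  then show ?thesis
    by (metis in_set_conv_nth)
qed

lemma foldl_and2: "foldl and2 K Ls = and_lang (K # Ls)"
proof (induction Ls arbitrary: K)
  case Nil
  show ?case using subset_conc_UNIV[of K] by (auto simp: mem_and_lang_iff)
next
  case (Cons L Ls)
  \<comment> \<open>The prefix conditions agree by \<open>conc_and2_UNIV\<close>. Given these, lying
    in \<open>and2 K L\<close> amounts to lying in \<open>K\<close> or in \<open>L\<close>.\<close>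
  have "and_lang (and2 K L # Ls) = and_lang (K # L # Ls)"
  proof (rule set_eqI)
    fix w
    show "w \<in> and_lang (and2 K L # Ls) \<longleftrightarrow> w \<in> and_lang (K # L # Ls)"
      unfolding mem_and_lang_iff list.set ball_simps bex_simps conc_and2_UNIV
      by (auto simp: and2_def)
  qed
  with Cons show ?case by simp
qed

section \<open>Leaves and arbitrary trees\<close>

lemma fo_sat_big_or: "fo_sat w \<sigma> (big_or \<phi>s) \<longleftrightarrow> (\<exists>\<phi>\<in>set \<phi>s. fo_sat w \<sigma> \<phi>)"
  by (induction \<phi>s rule: big_or.induct) auto

lemma fo_lang_tr_leaf:
  fixes \<gamma> :: "'p::finite pform"
  shows "fo_lang (tr_leaf \<gamma>) = {t. t \<noteq> [] \<and> psat (last t) \<gamma>}"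
proof (rule set_eqI)
  fix w :: "'p set list"
  \<comment> \<open>The position without successors is the last one; its existence accounts for the
    nonemptiness of the trace.\<close>
  have maximal: "i < length w \<and> (\<forall>j<length w. \<not> i < j) \<longleftrightarrow> w \<noteq> [] \<and> i = length w - 1" for i
  proof
    assume max: "i < length w \<and> (\<forall>j<length w. \<not> i < j)"
    then have "0 < length w" by linarith
    moreover from this have "\<not> i < length w - 1" using max by simp
    ultimately have "i = length w - 1" using max by linarith
    then show "w \<noteq> [] \<and> i = length w - 1" using \<open>0 < length w\<close> by simp
  qed (auto simp: Suc_le_eq)
  have "w \<Turnstile> tr_leaf \<gamma> \<longleftrightarrow> fo_sat w (\<lambda>_. 0) (tr_leaf \<gamma>)"
    using fo_free_adt_fo[of "Leaf \<gamma>"] by (intro fo_models_iff_sat) simp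
  also have "\<dots> \<longleftrightarrow> (\<exists>i. (i < length w \<and> (\<forall>j<length w. \<not> i < j)) \<and> psat (w ! i) \<gamma>)"
    by (auto simp: tr_leaf_def fo_sat_big_or valuations)
  also have "\<dots> \<longleftrightarrow> w \<noteq> [] \<and> psat (last w) \<gamma>"
    unfolding maximal by (auto simp: last_conv_nth)
  finally show "w \<in> fo_lang (tr_leaf \<gamma>) \<longleftrightarrow> w \<in> {t. t \<noteq> [] \<and> psat (last t) \<gamma>}"
    by (simp add: fo_lang_def)
qed

lemma fo_lang_adt_fo: "fo_lang (adt_fo \<theta>) = adt_sem \<theta>"
proof (induction \<theta>)
  case Eps
  show ?case by (auto simp: fo_lang_def fo_models_def)
next
  case (Leaf \<gamma>)
  show ?case by (simp add: fo_lang_tr_leaf)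
next
  case (OR_node \<theta> \<theta>s)
  have "fo_lang (adt_fo (OR_node \<theta> \<theta>s)) =
      foldl (\<union>) (fo_lang (adt_fo \<theta>)) (map fo_lang (map adt_fo \<theta>s))"
    unfolding adt_fo.simps
    by (intro fo_lang_foldl fo_lang_Or fo_free_tr) (auto simp: fo_free_adt_fo)
  with OR_node show ?case by (simp add: foldl_Un comp_def cong: map_cong)
next
  case (SAND_node \<theta> \<theta>s)
  have "fo_lang (adt_fo (SAND_node \<theta> \<theta>s)) =
      foldl conc (fo_lang (adt_fo \<theta>)) (map fo_lang (map adt_fo \<theta>s))"
    unfolding adt_fo.simps
    by (intro fo_lang_foldl fo_lang_tr_sand fo_free_tr) (auto simp: fo_free_adt_fo)
  with SAND_node show ?case by (simp add: foldl_conc comp_def cong: map_cong)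
next
  case (AND_node \<theta> \<theta>s)
  have "fo_lang (adt_fo (AND_node \<theta> \<theta>s)) =
      foldl and2 (fo_lang (adt_fo \<theta>)) (map fo_lang (map adt_fo \<theta>s))"
    unfolding adt_fo.simps
    by (intro fo_lang_foldl fo_lang_tr_and fo_free_tr) (auto simp: fo_free_adt_fo)
  with AND_node show ?case by (simp add: foldl_and2 comp_def cong: map_cong)
next
  case (Counter \<theta> \<theta>')
  have "w \<Turnstile> adt_fo (Counter \<theta> \<theta>') \<longleftrightarrow> w \<Turnstile> adt_fo \<theta> \<and> \<not> w \<Turnstile> adt_fo \<theta>'" for w
    using fo_free_adt_fo[of "Counter \<theta> \<theta>'"]
    by (simp add: fo_models_iff_sat[where \<sigma> = "\<lambda>_. 0"] fo_free_adt_fo)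
  with Counter show ?case by (auto simp: fo_lang_def)
qed


section \<open>Size\<close>

lemma fo_size_simps [simp]:
  "fo_size Bot = 1"
  "fo_size (Letter v x) = 4"
  "fo_size (Less x y) = 5"
  "fo_size (Neg \<phi>) = fo_size \<phi> + 1"
  "fo_size (Or \<phi> \<psi>) = fo_size \<phi> + fo_size \<psi> + 3"
  "fo_size (Ex x \<phi>) = fo_size \<phi> + 2"
  by (simp_all add: fo_size_def)

lemma fo_size_pos: "1 \<le> fo_size \<phi>"
  by (induction \<phi>) simp_all

text \<open>Only quantifiers grow: to their 2 symbols come a guard of size at most 6 and the 6
  symbols of the expanded \<open>And\<close>, and 2 + 6 + 6 = 7 * 2.\<close>

lemma fo_size_relativize:
  "(\<And>y. fo_size (g y) \<le> 6) \<Longrightarrow> fo_size (relativize g \<phi>) \<le> 7 * fo_size \<phi>"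
proof (induction \<phi>)
  case (Ex y \<phi>)
  have "fo_size (g y) \<le> 6" "fo_size (relativize g \<phi>) \<le> 7 * fo_size \<phi>"
    using Ex by simp_all
  then show ?case by simp
qed simp_all

lemma fo_size_rel:
  "fo_size (rel_le x \<phi>) \<le> 7 * fo_size \<phi>"
  "fo_size (rel_gt x \<phi>) \<le> 7 * fo_size \<phi>"
  "fo_size (rel_le0 \<phi>) \<le> 7 * fo_size \<phi>"
  by (simp_all add: rel_le_def rel_gt_def rel_le0_def fo_size_relativize)

text \<open>The constant is generous. The worst case is \<open>tr_and\<close>, with at most 16 times
  the sum of the two sizes plus 35; additive constants are absorbed because both sizes are at least
  1.\<close>

lemma fo_size_tr:
  "fo_size (Or \<phi> \<psi>) \<le> 64 * (fo_size \<phi> + fo_size \<psi>)"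
  "fo_size (tr_sand \<phi> \<psi>) \<le> 64 * (fo_size \<phi> + fo_size \<psi>)"
  "fo_size (tr_and \<phi> \<psi>) \<le> 64 * (fo_size \<phi> + fo_size \<psi>)"
  "fo_size (And \<phi> (Neg \<psi>)) \<le> 64 * (fo_size \<phi> + fo_size \<psi>)"
proof -
  define x where "x = fresh (fo_vars \<phi> \<union> fo_vars \<psi>)"
  note bounds = fo_size_pos[of \<phi>] fo_size_pos[of \<psi>] fo_size_rel(1,2)[of x \<phi>] fo_size_rel(1,2)[of x \<psi>]
    fo_size_rel(3)[of \<phi>] fo_size_rel(3)[of \<psi>]
  show "fo_size (Or \<phi> \<psi>) \<le> 64 * (fo_size \<phi> + fo_size \<psi>)"
    "fo_size (And \<phi> (Neg \<psi>)) \<le> 64 * (fo_size \<phi> + fo_size \<psi>)"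
    using bounds by simp_all
  show "fo_size (tr_sand \<phi> \<psi>) \<le> 64 * (fo_size \<phi> + fo_size \<psi>)"
    using bounds unfolding tr_sand_def Let_def x_def[symmetric] by simp
  show "fo_size (tr_and \<phi> \<psi>) \<le> 64 * (fo_size \<phi> + fo_size \<psi>)"
    using bounds unfolding tr_and_def Let_def x_def[symmetric] by simp
qed

text \<open>The factor \<open>D\<close> on the left-hand sides makes the bound multiplicative:
  \<open>D * (A + B) \<le> A * B\<close> as soon as \<open>A, B \<ge> 2 * D\<close>.\<close>

lemma scaled_bound_step:
  fixes D M :: nat
  assumes "s \<le> D * (a + b)" "D * a \<le> M ^ m" "D * b \<le> M ^ n" "2 * D \<le> M" "0 < m" "0 < n"
  shows "D * s \<le> M ^ (m + n)"
proof (cases "M = 0")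
  \<comment> \<open>Then also \<open>D = 0\<close>; for positive \<open>M\<close>, powers are
    monotone in the exponent.\<close>
  case True
  with assms show ?thesis by simp
next
  case False
  have "M ^ 1 \<le> M ^ m" "M ^ 1 \<le> M ^ n"
    using False assms by (intro power_increasing; simp)+
  then have "2 * D \<le> M ^ m" "2 * D \<le> M ^ n"
    using assms(4) by simp_all
  moreover have "D * (A + B) \<le> A * B" if "2 * D \<le> A" "2 * D \<le> B" for A B
  proof -
    have "2 * D * B \<le> A * B" using that(1) by (rule mult_le_mono1)
    moreover have "A * (2 * D) \<le> A * B" using that(2) by (rule mult_le_mono2)
    moreover have "2 * (D * (A + B)) = 2 * D * B + A * (2 * D)"
      by (simp add: distrib_left)
    ultimately show ?thesis by linarith
  qed
  ultimately have "D * (M ^ m + M ^ n) \<le> M ^ m * M ^ n" by blast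
  have "D * s \<le> D * (D * a + D * b)"
    using mult_le_mono2[OF assms(1), of D] by (simp add: distrib_left)
  also have "\<dots> \<le> D * (M ^ m + M ^ n)"
    using assms(2,3) by (intro mult_le_mono2 add_mono)
  also have "\<dots> \<le> M ^ m * M ^ n" by fact
  finally show ?thesis by (simp only: power_add)
qed

lemma pform_size_pos: "0 < pform_size \<gamma>"
  by (induction \<gamma>) simp_all

lemma adt_size_pos: "0 < adt_size \<theta>"
  by (induction \<theta>) (simp_all add: pform_size_pos)

text \<open>The accumulator is generalized to any formula with an exponent \<open>m\<close> for the
  children consumed so far; each further child adds its size to the exponent.\<close>

lemma fo_size_foldl:
  assumes step: "\<And>\<phi> \<psi>. fo_size (f \<phi> \<psi>) \<le> D * (fo_size \<phi> + fo_size \<psi>)" and M: "2 * D \<le> M"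
    and "0 < m" "D * fo_size \<phi> \<le> M ^ m"
    and "\<forall>\<theta>\<in>set \<theta>s. D * fo_size (adt_fo \<theta>) \<le> M ^ adt_size \<theta>"
  shows "D * fo_size (foldl f \<phi> (map adt_fo \<theta>s)) \<le> M ^ (m + sum_list (map adt_size \<theta>s))"
  using assms(3-)
proof (induction \<theta>s arbitrary: \<phi> m)
  case (Cons \<theta> \<theta>s)
  have "D * fo_size (f \<phi> (adt_fo \<theta>)) \<le> M ^ (m + adt_size \<theta>)"
    using Cons.prems by (intro scaled_bound_step[OF step _ _ M]) (simp_all add: adt_size_pos)
  then show ?case
    using Cons.IH[of "m + adt_size \<theta>" "f \<phi> (adt_fo \<theta>)"] Cons.prems by (simp add: add.assoc)
qed simp

text \<open>Every leaf has size at least 1, so a base \<open>M\<close> that dominates all leaf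
  formulas suffices for leaves, and \<open>scaled_bound_step\<close> handles inner nodes.\<close>

lemma fo_size_adt_fo:
  fixes \<theta> :: "'p::finite adt"
  assumes M: "2 * 64 \<le> M"
    and Eps: "64 * fo_size (adt_fo (Eps :: 'p adt)) \<le> M"
    and Leaf: "\<And>\<gamma> :: 'p pform. 64 * fo_size (tr_leaf \<gamma>) \<le> M"
  shows "64 * fo_size (adt_fo \<theta>) \<le> M ^ adt_size \<theta>"
proof (induction \<theta>)
  case Eps
  then show ?case using assms(2) by (simp only: adt_size.simps power_one_right)
next
  case (Leaf \<gamma>)
  have "M ^ 1 \<le> M ^ pform_size \<gamma>"
    using M pform_size_pos[of \<gamma>] by (intro power_increasing) auto
  with assms(3)[of \<gamma>] show ?case by simp
next
  case (OR_node \<theta> \<theta>s)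
  then show ?case unfolding adt_fo.simps adt_size.simps
    by (intro fo_size_foldl fo_size_tr M adt_size_pos) auto
next
  case (SAND_node \<theta> \<theta>s)
  then show ?case unfolding adt_fo.simps adt_size.simps
    by (intro fo_size_foldl fo_size_tr M adt_size_pos) auto
next
  case (AND_node \<theta> \<theta>s)
  then show ?case unfolding adt_fo.simps adt_size.simps
    by (intro fo_size_foldl fo_size_tr M adt_size_pos) auto
next
  case (Counter \<theta> \<theta>')
  then show ?case unfolding adt_fo.simps adt_size.simps
    by (intro scaled_bound_step[OF fo_size_tr(4) _ _ M] adt_size_pos)
qed

section \<open>Uniform bound for leaves and the final constant\<close>

lemma fo_size_big_or:
  "(\<And>\<phi>. \<phi> \<in> set \<phi>s \<Longrightarrow> fo_size \<phi> \<le> k) \<Longrightarrow> fo_size (big_or \<phi>s) \<le> 1 + (k + 3) * length \<phi>s"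
proof (induction \<phi>s rule: big_or.induct)
  case (3 \<phi> \<psi> \<psi>s)
  then have "fo_size \<phi> \<le> k" "fo_size (big_or (\<psi> # \<psi>s)) \<le> 1 + (k + 3) * length (\<psi> # \<psi>s)"
    by simp_all
  then show ?case by simp
qed simp_all

text \<open>The bound does not depend on \<gamma>: there are at most as many disjuncts as
  valuations, a constant for fixed propositions. Each costs 7 symbols, 4 for the atom and 3 for
  \<open>Or\<close>.\<close>

lemma fo_size_tr_leaf:
  fixes \<gamma> :: "'p::finite pform"
  shows "fo_size (tr_leaf \<gamma>) \<le> 20 + 7 * card (UNIV :: 'p set set)"
proof -
  have "length (valuations \<gamma>) \<le> card (UNIV :: 'p set set)"
    using distinct_card[OF valuations(1), of \<gamma>] card_mono[of UNIV "set (valuations \<gamma>)"] by simp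
  moreover have "fo_size (big_or (map (\<lambda>v. Letter v 0) (valuations \<gamma>)))
      \<le> 1 + 7 * length (valuations \<gamma>)"
    by (rule order_trans[OF fo_size_big_or[where k = 4]]) auto
  ultimately show ?thesis by (simp add: tr_leaf_def)
qed

theorem lemma1:
  "(\<forall>(\<theta> :: 'p::finite adt) (t :: 'p set list). t \<Turnstile> adt_fo \<theta> \<longleftrightarrow> t \<in> adt_sem \<theta>) \<and>
   (\<exists>c :: nat. \<forall>\<theta> :: 'p adt. fo_size (adt_fo \<theta>) \<le> 2 ^ (c * adt_size \<theta>))"
proof
  show "\<forall>(\<theta> :: 'p adt) t. t \<Turnstile> adt_fo \<theta> \<longleftrightarrow> t \<in> adt_sem \<theta>"
    using fo_lang_adt_fo by (auto simp: fo_lang_def)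
  \<comment> \<open>This \<open>c\<close> depends only on the number of propositions. By
    \<open>c \<le> 2 ^ c\<close>, the base \<open>2 ^ c\<close> dominates all leaf formulas together
    with the factor 64.\<close>
  define c where "c = 64 * (20 + 7 * card (UNIV :: 'p set set))"
  have "c \<le> 2 ^ c" by (simp add: less_imp_le)
  then have bound: "64 * s \<le> 2 ^ c" if "s \<le> 20 + 7 * card (UNIV :: 'p set set)" for s
    using that unfolding c_def by (meson le_trans mult_le_mono2)
  have "64 * fo_size (adt_fo \<theta>) \<le> (2 ^ c) ^ adt_size \<theta>" for \<theta> :: "'p adt"
  proof (rule fo_size_adt_fo)
    show "2 * 64 \<le> (2 :: nat) ^ c" using bound[of 2] by simp
    show "64 * fo_size (adt_fo (Eps :: 'p adt)) \<le> 2 ^ c" by (rule bound) simp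
    show "64 * fo_size (tr_leaf \<gamma>) \<le> 2 ^ c" for \<gamma> :: "'p pform"
      by (intro bound fo_size_tr_leaf)
  qed
  then have "fo_size (adt_fo \<theta>) \<le> 2 ^ (c * adt_size \<theta>)" for \<theta> :: "'p adt"
    unfolding power_mult by (rule le_trans[rotated]) simp
  then show "\<exists>c. \<forall>\<theta> :: 'p adt. fo_size (adt_fo \<theta>) \<le> 2 ^ (c * adt_size \<theta>)" by blast
qed

end
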